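(* Let $g:\mathbb{R}^d\to\mathbb{R}^n$ be differentiable, let $\lambda>0$, and define $\hat f(x,p)=\tfrac12\|g(x)+\lambda p\|^2$ for $(x,p)\in\mathbb{R}^d\times\mathbb{R}^n$. Then: (i) (Invexity) All stationary points of $\hat f$ are global minima of $\hat f$. In particular, for all $x,y\in\mathbb{R}^d$ and $p,q\in\mathbb{R}^n$, $$\hat f(x,p)-\hat f(y,q)\;\ge\;\bigl\langle \eta(x,p,y,q),\,\nabla\hat f(y,q)\bigr\rangle,$$ where $$\eta(x,p,y,q)=\begin{bmatrix} J_g(y) & \lambda I\end{bmatrix}^{\dagger}\Bigl(\bigl(g(x)+\lambda p\bigr)-\bigl(g(y)+\lambda q\bigr)\Bigr)\in\mathbb{R}^{d+n}.$$ (ii) (Polyak–Łojasiewicz inequality) For all $x\in\mathbb{R}^d$ and $p\in\mathbb{R}^n$, $$\hat f(x,p)\;\le\;\frac{1}{2\lambda^2}\,\bigl\|\nabla\hat f(x,p)\bigr\|^2 .$$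
   Context: $\|\cdot\|$ and $\langle\cdot,\cdot\rangle$ are the Euclidean norm and inner product. $J_g(y)\in\mathbb{R}^{n\times d}$ is the Jacobian of $g$ at $y$, $I$ is the $n\times n$ identity matrix, and $\begin{bmatrix} J_g(y) & \lambda I\end{bmatrix}\in\mathbb{R}^{n\times(d+n)}$ is the horizontally concatenated matrix. $M^\dagger$ denotes the Moore–Penrose inverse of a matrix $M$. $\nabla\hat f$ is the gradient jointly in $(x,p)$, viewed as a vector in $\mathbb{R}^{d+n}$. A stationary point of $\hat f$ is a point $(x,p)$ with $\nabla\hat f(x,p)=0$. *)

theory Defs
  imports "HOL-Analysis.Analysis"
begin

definition gradient :: "('a::real_inner \<Rightarrow> real) \<Rightarrow> 'a \<Rightarrow> 'a" where
  "gradient f z = (THE D. GDERIV f z :> D)"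

lemma gradient_eqI:
  assumes "GDERIV f z :> D"
  shows "gradient f z = D"
  unfolding gradient_def
proof (rule the_equality, rule assms)
  fix E assume "GDERIV f z :> E"
  with assms have "(\<lambda>h. inner h E) = (\<lambda>h. inner h D)"
    unfolding gderiv_def by (metis has_derivative_unique)
  then have "inner (E - D) (E - D) = 0"
    by (metis inner_diff_right right_minus_eq)
  then show "E = D" by simp
qed

text \<open>The \<open>(d + n)\<close>-dimensional space is \<^typ>\<open>real ^ ('d + 'n)\<close>, with the \<open>d\<close>-block indexed
  by \<^const>\<open>Inl\<close> and the \<open>n\<close>-block by \<^const>\<open>Inr\<close>.\<close>

definition stack :: "'a ^ 'd \<Rightarrow> 'a ^ 'n \<Rightarrow> 'a ^ ('d + 'n)" where
  "stack x p = (\<chi> j. case j of Inl k \<Rightarrow> x $ k | Inr k \<Rightarrow> p $ k)"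

definition hconcat :: "'a ^ 'd ^ 'm \<Rightarrow> 'a ^ 'n ^ 'm \<Rightarrow> 'a ^ ('d + 'n) ^ 'm" where
  "hconcat A B = (\<chi> i. stack (A $ i) (B $ i))"

definition joint_gradient ::
    "((real ^ 'd) \<times> (real ^ 'n) \<Rightarrow> real) \<Rightarrow> real ^ 'd \<Rightarrow> real ^ 'n \<Rightarrow> real ^ ('d + 'n)" where
  "joint_gradient f x p = stack (fst (gradient f (x, p))) (snd (gradient f (x, p)))"

definition stationary_point ::
    "((real ^ 'd) \<times> (real ^ 'n) \<Rightarrow> real) \<Rightarrow> real ^ 'd \<Rightarrow> real ^ 'n \<Rightarrow> bool" where
  "stationary_point f x p \<longleftrightarrow> joint_gradient f x p = 0"

text \<open>The four Penrose conditions.\<close>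

definition is_pseudoinverse :: "real ^ 'n ^ 'm \<Rightarrow> real ^ 'm ^ 'n \<Rightarrow> bool" where
  "is_pseudoinverse M X \<longleftrightarrow>
     M ** X ** M = M \<and> X ** M ** X = X \<and>
     transpose (M ** X) = M ** X \<and> transpose (X ** M) = X ** M"

definition pseudoinverse :: "real ^ 'n ^ 'm \<Rightarrow> real ^ 'm ^ 'n" where
  "pseudoinverse M = (THE X. is_pseudoinverse M X)"

lemma is_pseudoinverse_unique:
  assumes X: "is_pseudoinverse M X" and Y: "is_pseudoinverse M Y"
  shows "X = Y"
proof -
  have "M ** X = (M ** Y) ** (M ** X)"
    using Y by (simp add: is_pseudoinverse_def matrix_mul_assoc)
  also have "\<dots> = transpose ((M ** X) ** (M ** Y))"
    using X Y by (simp add: is_pseudoinverse_def matrix_transpose_mul)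
  also have "\<dots> = M ** Y"
    using X Y by (simp add: is_pseudoinverse_def matrix_mul_assoc)
  finally have MX: "M ** X = M ** Y" .
  have "X ** M = (X ** M) ** (Y ** M)"
    using Y by (simp add: is_pseudoinverse_def flip: matrix_mul_assoc)
  also have "\<dots> = transpose ((Y ** M) ** (X ** M))"
    using X Y by (simp add: is_pseudoinverse_def matrix_transpose_mul)
  also have "\<dots> = Y ** M"
    using X Y by (simp add: is_pseudoinverse_def flip: matrix_mul_assoc)
  finally have XM: "X ** M = Y ** M" .
  have "X = X ** M ** X" using X by (simp add: is_pseudoinverse_def)
  also have "\<dots> = Y ** M ** Y" using XM MX by (metis matrix_mul_assoc)
  also have "\<dots> = Y" using Y by (simp add: is_pseudoinverse_def)
  finally show ?thesis .
qed

lemma pseudoinverse_eqI: "is_pseudoinverse M X \<Longrightarrow> pseudoinverse M = X"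
  unfolding pseudoinverse_def by (blast intro: the_equality is_pseudoinverse_unique)

definition fhat ::
    "(real ^ 'd \<Rightarrow> real ^ 'n) \<Rightarrow> real \<Rightarrow> (real ^ 'd) \<times> (real ^ 'n) \<Rightarrow> real" where
  "fhat g lam = (\<lambda>(x, p). (norm (g x + lam *\<^sub>R p))\<^sup>2 / 2)"

definition eta ::
    "(real ^ 'd \<Rightarrow> real ^ 'n) \<Rightarrow> real \<Rightarrow> real ^ 'd \<Rightarrow> real ^ 'n \<Rightarrow> real ^ 'd \<Rightarrow> real ^ 'n \<Rightarrow>
      real ^ ('d + 'n)" where
  "eta g lam x p y q =
     pseudoinverse (hconcat (jacobian g (at y)) (lam *\<^sub>R mat 1)) *v
       ((g x + lam *\<^sub>R p) - (g y + lam *\<^sub>R q))"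

end

theory Submission
  imports Defs
begin

text \<open>
  Write \<open>r = g y + \<lambda> q\<close> for the residual at \<open>(y, q)\<close> and \<open>M = [J\<^sub>g(y)  \<lambda>I]\<close> for the Jacobian of
  \<open>(y, q) \<mapsto> r\<close>. By the chain rule the joint gradient of \<open>fhat\<close> is \<open>M\<^sup>T r\<close>
  (\<open>joint_gradient_fhat\<close>). The block \<open>\<lambda>I\<close> makes \<open>M\<^sup>T\<close> stretch by a factor of at least \<open>\<lambda>\<close>, because
  \<open>\<parallel>M\<^sup>T r\<parallel>\<^sup>2 = \<parallel>J\<^sub>g(y)\<^sup>T r\<parallel>\<^sup>2 + \<lambda>\<^sup>2 \<parallel>r\<parallel>\<^sup>2\<close> (\<open>norm_transpose_hconcat_scaled_identity\<close>), and both
  claims rest on this.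

  The bound \<open>\<parallel>M\<^sup>T r\<parallel>\<^sup>2 \<ge> \<lambda>\<^sup>2 \<parallel>r\<parallel>\<^sup>2\<close> is the Polyak--Lojasiewicz inequality once \<open>\<parallel>r\<parallel>\<^sup>2\<close> is read as \<open>2 fhat (y, q)\<close>. That inequality
  in turn forces \<open>fhat\<close> to vanish at a stationary point, so such a point is a global minimum of the
  nonnegative function \<open>fhat\<close>.

  The same bound makes \<open>M\<^sup>T\<close> injective, so that \<open>M M\<^sup>\<dagger> = I\<close> (\<open>pseudoinverse_right_inverse\<close>). With
  \<open>s = g x + \<lambda> p\<close> this gives
  \<open>\<langle>M\<^sup>\<dagger>(s - r), M\<^sup>T r\<rangle> = \<langle>M M\<^sup>\<dagger>(s - r), r\<rangle> = \<langle>s - r, r\<rangle>\<close>, and the invexity inequality becomes the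
  convexity inequality of \<open>\<parallel>\<cdot>\<parallel>\<^sup>2 / 2\<close>, whose gap is \<open>\<parallel>s - r\<parallel>\<^sup>2 / 2\<close>. All the nonlinearity of \<open>g\<close> is
  absorbed by \<open>\<eta>\<close>.
\<close>

text \<open>
  The matrices \<open>M\<^sup>T\<close> are kept as transposes throughout, in place of the row-vector product
  \<open>v* M\<close> that the simplifier prefers.
\<close>

declare transpose_matrix_vector [simp del]

lemma inner_transpose_mult_vector:
  fixes A :: "real ^ 'n ^ 'm"
  shows "v \<bullet> (transpose A *v r) = (A *v v) \<bullet> r"
  by (metis dot_lmul_matrix inner_commute transpose_matrix_vector)

lemma norm_stack_squared:
  fixes a :: "real ^ 'd" and b :: "real ^ 'n"
  shows "(norm (stack a b))\<^sup>2 = (norm a)\<^sup>2 + (norm b)\<^sup>2"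
  by (simp add: power2_norm_eq_inner inner_vec_def stack_def sum.Plus flip: UNIV_Plus_UNIV)

lemma transpose_hconcat_mult_vector:
  fixes A :: "real ^ 'd ^ 'm" and B :: "real ^ 'n ^ 'm"
  shows "transpose (hconcat A B) *v r = stack (transpose A *v r) (transpose B *v r)"
  by (simp add: vec_eq_iff hconcat_def stack_def transpose_def matrix_vector_mult_def
      split: sum.split)

lemma transpose_hconcat_scaled_identity:
  fixes A :: "real ^ 'd ^ 'n"
  shows "transpose (hconcat A (c *\<^sub>R mat 1)) *v r = stack (transpose A *v r) (c *\<^sub>R r)"
  by (simp add: transpose_hconcat_mult_vector transpose_scalar scaleR_matrix_vector_assoc[symmetric])

lemma norm_transpose_hconcat_scaled_identity:
  fixes A :: "real ^ 'd ^ 'n"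
  shows "(norm (transpose (hconcat A (c *\<^sub>R mat 1)) *v r))\<^sup>2 =
    (norm (transpose A *v r))\<^sup>2 + c\<^sup>2 * (norm r)\<^sup>2"
  by (simp add: transpose_hconcat_scaled_identity norm_stack_squared power_mult_distrib)

text \<open>
  Injectivity of \<open>M\<^sup>T\<close> makes the Gram matrix \<open>M M\<^sup>T\<close> invertible, since
  \<open>\<langle>x, M M\<^sup>T x\<rangle> = \<parallel>M\<^sup>T x\<parallel>\<^sup>2\<close>. Then \<open>M\<^sup>T (M M\<^sup>T)\<^sup>-\<^sup>1\<close> is a right inverse of \<open>M\<close> that satisfies the
  Penrose conditions, so it is the pseudoinverse.
\<close>

lemma pseudoinverse_right_inverse:
  fixes M :: "real ^ 'n ^ 'm"
  assumes inj: "\<And>x. transpose M *v x = 0 \<Longrightarrow> x = 0"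
  shows "M ** pseudoinverse M = mat 1"
proof -
  define K where "K = M ** transpose M"
  have "x = 0" if "K *v x = 0" for x
  proof -
    have "(transpose M *v x) \<bullet> (transpose M *v x) = x \<bullet> (K *v x)"
      by (simp add: K_def inner_transpose_mult_vector matrix_vector_mul_assoc inner_commute)
    then show ?thesis using that inj by simp
  qed
  then obtain L where LK: "L ** K = mat 1"
    by (meson matrix_left_invertible_ker)
  then have KL: "K ** L = mat 1"
    by (simp add: matrix_left_right_inverse)
  have "transpose K = K"
    by (simp add: K_def matrix_transpose_mul)
  then have "transpose L ** K = mat 1"
    by (metis KL matrix_transpose_mul transpose_mat)
  then have L_sym: "transpose L = L"
    by (metis KL matrix_mul_assoc matrix_mul_lid matrix_mul_rid)
  have MX: "M ** (transpose M ** L) = mat 1"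
    using KL by (simp add: K_def matrix_mul_assoc)
  have "transpose (transpose M ** L ** M) = transpose M ** L ** M"
    by (simp add: matrix_transpose_mul L_sym matrix_mul_assoc)
  moreover have "transpose M ** L ** M ** (transpose M ** L) = transpose M ** L"
    using MX by (metis matrix_mul_assoc matrix_mul_rid)
  ultimately have "is_pseudoinverse M (transpose M ** L)"
    by (simp add: is_pseudoinverse_def MX)
  then show ?thesis
    using MX by (simp add: pseudoinverse_eqI)
qed

text \<open>The chain rule, with \<open>D\<close> in the role of the adjoint of \<open>F'\<close> applied to \<open>F z\<close>.\<close>

lemma GDERIV_half_norm_squared:
  fixes F :: "'a::real_inner \<Rightarrow> 'b::real_inner"
  assumes "(F has_derivative F') (at z)" and "\<And>h. F' h \<bullet> F z = h \<bullet> D"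
  shows "GDERIV (\<lambda>z. (norm (F z))\<^sup>2 / 2) z :> D"
proof -
  have "((\<lambda>z. (F z \<bullet> F z) / 2) has_derivative (\<lambda>h. (F z \<bullet> F' h + F' h \<bullet> F z) / 2)) (at z)"
    by (auto intro!: derivative_eq_intros assms(1))
  then show ?thesis
    by (simp add: gderiv_def power2_norm_eq_inner assms(2) inner_commute[of "F z"])
qed

lemma joint_gradient_fhat:
  fixes g :: "real ^ 'd \<Rightarrow> real ^ 'n"
  assumes "g differentiable (at y)"
  shows "joint_gradient (fhat g lam) y q =
    transpose (hconcat (jacobian g (at y)) (lam *\<^sub>R mat 1)) *v (g y + lam *\<^sub>R q)"
proof -
  define J where "J = jacobian g (at y)"
  define r where "r = g y + lam *\<^sub>R q"
  have "(g has_derivative (\<lambda>h. J *v h)) (at y)"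
    using assms by (simp add: J_def jacobian_works)
  then have "((\<lambda>z. g (fst z)) has_derivative (\<lambda>h. J *v fst h)) (at (y, q))"
    by (intro has_derivative_compose[OF has_derivative_fst[OF has_derivative_ident], of g "(*v) J"])
      simp
  then have "((\<lambda>z. g (fst z) + lam *\<^sub>R snd z) has_derivative
      (\<lambda>h. J *v fst h + lam *\<^sub>R snd h)) (at (y, q))"
    by (auto intro!: derivative_eq_intros)
  moreover have "(J *v fst h + lam *\<^sub>R snd h) \<bullet> r = h \<bullet> (transpose J *v r, lam *\<^sub>R r)" for h
    by (cases h) (simp add: inner_add_left inner_transpose_mult_vector)
  ultimately have "GDERIV (\<lambda>z. (norm (g (fst z) + lam *\<^sub>R snd z))\<^sup>2 / 2) (y, q) :>
      (transpose J *v r, lam *\<^sub>R r)"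
    by (intro GDERIV_half_norm_squared) (auto simp: r_def)
  moreover have "fhat g lam = (\<lambda>z. (norm (g (fst z) + lam *\<^sub>R snd z))\<^sup>2 / 2)"
    by (auto simp: fhat_def)
  ultimately have "gradient (fhat g lam) (y, q) = (transpose J *v r, lam *\<^sub>R r)"
    by (simp add: gradient_eqI)
  then show ?thesis
    by (simp add: joint_gradient_def transpose_hconcat_scaled_identity J_def r_def)
qed

theorem theorem2:
  fixes g :: "real ^ 'd \<Rightarrow> real ^ 'n" and lam :: real
  assumes "\<And>x. g differentiable (at x)" and "lam > 0"
  shows "(\<forall>y q. stationary_point (fhat g lam) y q \<longrightarrow>
            (\<forall>x p. fhat g lam (y, q) \<le> fhat g lam (x, p))) \<and>
         (\<forall>x y p q. fhat g lam (x, p) - fhat g lam (y, q) \<ge>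
            eta g lam x p y q \<bullet> joint_gradient (fhat g lam) y q) \<and>
         (\<forall>x p. fhat g lam (x, p) \<le>
            1 / (2 * lam\<^sup>2) * (norm (joint_gradient (fhat g lam) x p))\<^sup>2)"
proof -
  define M where "M y = hconcat (jacobian g (at y)) (lam *\<^sub>R mat 1)" for y
  have grad: "joint_gradient (fhat g lam) y q = transpose (M y) *v (g y + lam *\<^sub>R q)" for y q
    using assms(1) by (simp add: M_def joint_gradient_fhat)
  have expanding: "lam\<^sup>2 * (norm r)\<^sup>2 \<le> (norm (transpose (M y) *v r))\<^sup>2" for y r
    by (simp add: M_def norm_transpose_hconcat_scaled_identity)
  have PL: "fhat g lam (y, q) \<le> 1 / (2 * lam\<^sup>2) * (norm (joint_gradient (fhat g lam) y q))\<^sup>2"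
    for y q
    using expanding[of "g y + lam *\<^sub>R q" y] \<open>lam > 0\<close>
    unfolding grad by (simp add: fhat_def field_simps)
  have invex: "eta g lam x p y q \<bullet> joint_gradient (fhat g lam) y q
      \<le> fhat g lam (x, p) - fhat g lam (y, q)" for x p y q
  proof -
    define r where "r = g y + lam *\<^sub>R q"
    define s where "s = g x + lam *\<^sub>R p"
    have "v = 0" if "transpose (M y) *v v = 0" for v
      using expanding[of v y] that \<open>lam > 0\<close> by (simp add: mult_le_0_iff)
    then have right_inv: "M y ** pseudoinverse (M y) = mat 1"
      by (rule pseudoinverse_right_inverse)
    have "eta g lam x p y q \<bullet> joint_gradient (fhat g lam) y q =
        (pseudoinverse (M y) *v (s - r)) \<bullet> (transpose (M y) *v r)"
      by (simp add: eta_def grad M_def r_def s_def)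
    also have "\<dots> = (M y *v (pseudoinverse (M y) *v (s - r))) \<bullet> r"
      by (rule inner_transpose_mult_vector)
    also have "\<dots> = (s - r) \<bullet> r"
      by (simp add: matrix_vector_mul_assoc right_inv)
    also have "\<dots> = (norm s)\<^sup>2 / 2 - (norm r)\<^sup>2 / 2 - (norm (s - r))\<^sup>2 / 2"
      by (simp add: power2_norm_eq_inner inner_diff_left inner_diff_right inner_commute field_simps)
    also have "\<dots> \<le> fhat g lam (x, p) - fhat g lam (y, q)"
      by (simp add: fhat_def r_def s_def)
    finally show ?thesis .
  qed
  have "fhat g lam (y, q) \<le> fhat g lam (x, p)" if "stationary_point (fhat g lam) y q" for x p y q
  proof -
    have "fhat g lam (y, q) \<le> 0"
      using PL[of y q] that by (simp add: stationary_point_def)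
    also have "0 \<le> fhat g lam (x, p)"
      by (simp add: fhat_def)
    finally show ?thesis .
  qed
  then show ?thesis
    using invex PL by blast
qed

end
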